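(* Let $\delta_1,\dots,\delta_n\in\mathbb C$ and $\boldsymbol u_o=(u_o^1,\dots,u_o^n)\in\mathbb C^n$, and assume that one of the following holds: (1) the numbers $u_o^1,\dots,u_o^n$ are pairwise distinct; (2) the numbers $u^1_o,\dots,u^n_o$ are not pairwise distinct, and whenever $u_o^i=u_o^j$ with $i\neq j$ one has $\delta_i-\delta_j\notin\mathbb Z\setminus\{0\}$. Let $F(\boldsymbol u)=F_o+\sum_{k\ge1}\sum_{\ell_1,\dots,\ell_k=1}^n\frac1{k!}F^{(\boldsymbol\ell)}\prod_{j=1}^k(u^{\ell_j}-u_o^{\ell_j})$ be a formal power series in $\boldsymbol u-\boldsymbol u_o$ with coefficients in the $n\times n$ complex matrices, whose off-diagonal entries $F^i_j$ ($i\ne j$) are formal solutions of the following system, where $\partial_k=\partial/\partial u^k$: $$\partial_kF^i_j=F^i_kF^k_j\quad(i,j,k\text{ distinct}),\qquad \sum_k\partial_kF^i_j=0\quad(i\ne j),$$ $$\sum_ku^k\partial_kF^i_j=(\delta_j-\delta_i-1)F^i_j\quad(i\neq j),$$ $$(u^j-u^i)\partial_iF^i_j=\sum_{k\ne i,j}(u^k-u^j)F^i_kF^k_j-(\delta_j-\delta_i-1)F^i_j\quad(i\ne j),$$ $$(u^i-u^j)\partial_jF^i_j=\sum_{k\neq i,j}(u^k-u^i)F^i_kF^k_j-(\delta_j-\delta_i-1)F^i_j\quad(i\ne j).$$ Then the off-diagonal entries of all the coefficients $F^{(\boldsymbol\ell)}$ are uniquely determined by the off-diagonal entries of $F_o$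.
   Context: $F^i_j$ denotes the entry of $F$ in row $i$ and column $j$. The displayed system is the (generalized) Darboux-Egoroff system together with its homogeneity consequences. *)

theory Defs
  imports "HOL-Analysis.Analysis" "HOL-Combinatorics.Multiset_Permutations"
begin

section \<open>Formal power series in several variables\<close>

text \<open>
  Formal power series in commuting variables indexed by the type \<open>'n\<close>. A monomial is the
  multiset of the variables occurring in it, each with its exponent as multiplicity.
\<close>

typedef ('n, 'a) mfps = "UNIV :: ('n multiset \<Rightarrow> 'a) set"
  morphisms mfps_nth Abs_mfps ..

lemma mfps_nth_Abs [simp]: "mfps_nth (Abs_mfps f) = f"
  by (simp add: Abs_mfps_inverse)

lemma mfps_eqI: "(\<And>M. mfps_nth f M = mfps_nth g M) \<Longrightarrow> f = g"
  by (metis ext mfps_nth_inject)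

lemma finite_multiset_splits: "finite {(A, B). A + B = (M :: 'n multiset)}"
proof (rule finite_subset)
  show "{(A, B). A + B = M} \<subseteq> {A. A \<subseteq># M} \<times> {A. A \<subseteq># M}"
    by (auto simp: mset_subset_eq_add_left mset_subset_eq_add_right)
  have "{A. A \<subseteq># M} \<subseteq> mset ` {xs. set xs \<subseteq> set_mset M \<and> length xs \<le> size M}"
  proof
    fix A assume "A \<in> {A. A \<subseteq># M}"
    moreover obtain xs where "mset xs = A"
      using ex_mset by blast
    ultimately show "A \<in> mset ` {xs. set xs \<subseteq> set_mset M \<and> length xs \<le> size M}"
      by (auto intro!: image_eqI[of _ _ xs] dest: mset_subset_eqD size_mset_mono)
  qed
  then have "finite {A. A \<subseteq># M}"
    by (rule finite_subset) (auto intro!: finite_imageI finite_lists_length_le)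
  then show "finite ({A. A \<subseteq># M} \<times> {A. A \<subseteq># M})"
    by simp
qed

instantiation mfps :: (type, comm_ring_1) comm_ring_1
begin

definition "0 = Abs_mfps (\<lambda>M. 0)"
definition "1 = Abs_mfps (\<lambda>M. if M = {#} then 1 else 0)"
definition "f + g = Abs_mfps (\<lambda>M. mfps_nth f M + mfps_nth g M)"
definition "f - g = Abs_mfps (\<lambda>M. mfps_nth f M - mfps_nth g M)"
definition "- f = Abs_mfps (\<lambda>M. - mfps_nth f M)"
definition "f * g = Abs_mfps (\<lambda>M. \<Sum>(A, B) | A + B = M. mfps_nth f A * mfps_nth g B)"

instance
proof
  fix f g h :: "('a, 'b) mfps"
  show "f * g * h = f * (g * h)"
  proof (rule mfps_eqI)
    fix M :: "'a multiset"
    let ?t = "\<lambda>A B C. mfps_nth f A * mfps_nth g B * mfps_nth h C"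
    have "mfps_nth (f * g * h) M
      = (\<Sum>p\<in>{(D, C). D + C = M}. \<Sum>q\<in>{(A, B). A + B = fst p}. ?t (fst q) (snd q) (snd p))"
      by (simp add: times_mfps_def case_prod_beta sum_distrib_right)
    also have "\<dots> = (\<Sum>(p, q)\<in>(SIGMA p:{(D, C). D + C = M}. {(A, B). A + B = fst p}).
        ?t (fst q) (snd q) (snd p))"
      by (rule sum.Sigma) (auto simp: finite_multiset_splits)
    also have "\<dots> = (\<Sum>(p, q)\<in>(SIGMA p:{(A, D). A + D = M}. {(B, C). B + C = snd p}).
        ?t (fst p) (fst q) (snd q))"
      by (rule sum.reindex_bij_witness[of _
            "\<lambda>((A, D), (B, C)). ((A + B, C), (A, B))" "\<lambda>((D, C), (A, B)). ((A, B + C), (B, C))"])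
         (auto simp: add.assoc)
    also have "\<dots> = (\<Sum>p\<in>{(A, D). A + D = M}. \<Sum>q\<in>{(B, C). B + C = snd p}.
        ?t (fst p) (fst q) (snd q))"
      by (rule sum.Sigma[symmetric]) (auto simp: finite_multiset_splits)
    also have "\<dots> = mfps_nth (f * (g * h)) M"
      by (simp add: times_mfps_def case_prod_beta sum_distrib_left mult.assoc)
    finally show "mfps_nth (f * g * h) M = mfps_nth (f * (g * h)) M" .
  qed
  show "f * g = g * f"
  proof (rule mfps_eqI)
    fix M :: "'a multiset"
    show "mfps_nth (f * g) M = mfps_nth (g * f) M"
      unfolding times_mfps_def mfps_nth_Abs
      by (rule sum.reindex_bij_witness[of _ prod.swap prod.swap]) (auto simp: ac_simps)
  qed
  show "1 * f = f"
  proof (rule mfps_eqI)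
    fix M :: "'a multiset"
    have "mfps_nth (1 * f) M
      = (\<Sum>p\<in>{(A, B). A + B = M}. if ({#}, M) = p then mfps_nth f M else 0)"
      unfolding times_mfps_def one_mfps_def mfps_nth_Abs
      by (rule sum.cong) (auto simp: prod_eq_iff)
    also have "\<dots> = mfps_nth f M"
      by (subst sum.delta') (auto simp: finite_multiset_splits)
    finally show "mfps_nth (1 * f) M = mfps_nth f M" .
  qed
  show "(f + g) * h = f * h + g * h"
    by (rule mfps_eqI) (simp add: times_mfps_def plus_mfps_def case_prod_beta
        distrib_right sum.distrib)
  show "(0 :: ('a, 'b) mfps) \<noteq> 1"
  proof
    assume "(0 :: ('a, 'b) mfps) = 1"
    then have "mfps_nth (0 :: ('a, 'b) mfps) {#} = mfps_nth 1 {#}"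
      by (rule arg_cong)
    then show False
      by (simp add: zero_mfps_def one_mfps_def)
  qed
qed (rule mfps_eqI; simp add: plus_mfps_def minus_mfps_def uminus_mfps_def zero_mfps_def
      algebra_simps)+

end

definition mfps_const :: "'a::zero \<Rightarrow> ('n, 'a) mfps" where
  "mfps_const c = Abs_mfps (\<lambda>M. if M = {#} then c else 0)"

definition mfps_var :: "'n \<Rightarrow> ('n, 'a::zero_neq_one) mfps" where
  "mfps_var k = Abs_mfps (\<lambda>M. if M = {#k#} then 1 else 0)"

definition mfps_deriv :: "'n \<Rightarrow> ('n, 'a::comm_ring_1) mfps \<Rightarrow> ('n, 'a) mfps" where
  "mfps_deriv k f = Abs_mfps (\<lambda>M. of_nat (count M k + 1) * mfps_nth f (add_mset k M))"


section \<open>Matrix-valued series around a base point\<close>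

text \<open>
  All series below are series in \<open>u - uo\<close>: the variable \<open>mfps_var k\<close> stands for
  \<open>u\<^sup>k - uo\<^sup>k\<close>. A family \<open>c\<close> of coefficients indexed by lists \<open>l = [l 1, ..., l k]\<close> defines
  the series that sums \<open>c l / k!\<close> times the product of the variables \<open>l 1, ..., l k\<close> over all
  lists \<open>l\<close> of all lengths \<open>k\<close>, with constant term \<open>c []\<close>. Its coefficient at a monomial \<open>M\<close>
  collects the lists that enumerate \<open>M\<close>.
\<close>

definition mfps_of_coeffs :: "('n list \<Rightarrow> 'a::real_vector) \<Rightarrow> ('n, 'a) mfps" where
  "mfps_of_coeffs c =
    Abs_mfps (\<lambda>M. \<Sum>l\<in>permutations_of_multiset M. (1 / fact (size M)) *\<^sub>R c l)"

text \<open>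
  The variables commute, so the series only determines the symmetric part of \<open>c\<close>; as usual,
  the coefficients are taken to be symmetric in the indices, which makes \<open>c l\<close> the iterated
  partial derivative at \<open>uo\<close> along \<open>l\<close>.
\<close>

definition symmetric_coeffs :: "('n list \<Rightarrow> 'a) \<Rightarrow> bool" where
  "symmetric_coeffs c \<longleftrightarrow> (\<forall>l l'. mset l = mset l' \<longrightarrow> c l = c l')"

definition mfps_entry :: "('n, 'a ^ 'm ^ 'k) mfps \<Rightarrow> 'k \<Rightarrow> 'm \<Rightarrow> ('n, 'a) mfps" where
  "mfps_entry F i j = Abs_mfps (\<lambda>M. mfps_nth F M $ i $ j)"

definition coord_at :: "complex ^ 'n \<Rightarrow> 'n \<Rightarrow> ('n, complex) mfps" where
  "coord_at uo k = mfps_const (uo $ k) + mfps_var k"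

definition darboux_egoroff_formal_solution ::
  "('n::finite \<Rightarrow> complex) \<Rightarrow> complex ^ 'n \<Rightarrow> ('n, complex ^ 'n ^ 'n) mfps \<Rightarrow> bool" where
  "darboux_egoroff_formal_solution \<delta> uo F \<longleftrightarrow>
    (let f = mfps_entry F; u = coord_at uo; D = mfps_deriv in
      (\<forall>i j k. i \<noteq> j \<and> j \<noteq> k \<and> i \<noteq> k \<longrightarrow> D k (f i j) = f i k * f k j) \<and>
      (\<forall>i j. i \<noteq> j \<longrightarrow>
        (\<Sum>k\<in>UNIV. D k (f i j)) = 0 \<and>
        (\<Sum>k\<in>UNIV. u k * D k (f i j)) = mfps_const (\<delta> j - \<delta> i - 1) * f i j \<and>
        (u j - u i) * D i (f i j) =
          (\<Sum>k\<in>UNIV - {i, j}. (u k - u j) * f i k * f k j)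
            - mfps_const (\<delta> j - \<delta> i - 1) * f i j \<and>
        (u i - u j) * D j (f i j) =
          (\<Sum>k\<in>UNIV - {i, j}. (u k - u i) * f i k * f k j)
            - mfps_const (\<delta> j - \<delta> i - 1) * f i j))"

end

theory Submission
  imports Defs
begin

text \<open>
  Fix two solutions \<open>f\<close> and \<open>g\<close> whose off-diagonal constant terms agree. The off-diagonal
  coefficients are compared degree by degree, and agreement up to some degree is a congruence
  modulo a power of the maximal ideal, \<open>mfps_agree\<close> below. Write \<open>x\<^sub>k\<close> for the variable
  \<open>u\<^sup>k - u\<^sub>o\<^sup>k\<close>, \<open>E\<close> for the Euler operator \<open>\<Sum>k. x\<^sub>k \<partial>\<^sub>k\<close> and \<open>\<mu>\<close> for
  \<open>\<delta>\<^sub>j - \<delta>\<^sub>i - 1\<close>. Subtracting \<open>a\<close> times the translation equation from the homogeneity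
  equation gives, for every constant \<open>a\<close>,
  \<open>(\<Sum>k. (u\<^sub>o\<^sup>k - a) \<partial>\<^sub>k f\<^sub>i\<^sub>j) + E f\<^sub>i\<^sub>j = \<mu> f\<^sub>i\<^sub>j\<close>,
  where \<open>\<partial>\<^sub>k f\<^sub>i\<^sub>j = f\<^sub>i\<^sub>k f\<^sub>k\<^sub>j\<close> unless \<open>k\<close> is \<open>i\<close> or \<open>j\<close>
  (\<open>shifted_homogeneity\<close>).

  Suppose that \<open>f\<close> and \<open>g\<close> agree in all degrees below \<open>n > 0\<close>. If \<open>u\<^sub>o\<^sup>i \<noteq> u\<^sub>o\<^sup>j\<close>, the choice
  \<open>a = u\<^sub>o\<^sup>j\<close> removes \<open>\<partial>\<^sub>j f\<^sub>i\<^sub>j\<close> and expresses \<open>\<partial>\<^sub>i f\<^sub>i\<^sub>j\<close> in degrees below \<open>n\<close>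
  through coefficients that are already known to agree; \<open>a = u\<^sub>o\<^sup>i\<close> does the same for
  \<open>\<partial>\<^sub>j f\<^sub>i\<^sub>j\<close>. All partial derivatives then agree below \<open>n\<close>, so the series agree in degree
  \<open>n\<close> (\<open>agree_step_distinct\<close>).

  If \<open>u\<^sub>o\<^sup>i = u\<^sub>o\<^sup>j\<close>, the choice \<open>a = u\<^sub>o\<^sup>i\<close> removes both derivatives. The products left over
  have a nonzero factor \<open>u\<^sub>o\<^sup>k - a\<close> only when \<open>u\<^sub>o\<^sup>k\<close> differs from \<open>u\<^sub>o\<^sup>i\<close> and \<open>u\<^sub>o\<^sup>j\<close>, so
  the first case shows that they agree in degree \<open>n\<close> too. As \<open>E\<close> is multiplication by \<open>n\<close>
  in degree \<open>n\<close>, the difference of the degree \<open>n\<close> parts is killed by \<open>n - \<mu>\<close>, and this is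
  nonzero: otherwise \<open>\<delta>\<^sub>j - \<delta>\<^sub>i = n + 1\<close> would be a nonzero integer
  (\<open>agree_step_coalescing\<close>).
\<close>

section \<open>Coefficients\<close>

lemma mfps_nth_0 [simp]: "mfps_nth 0 M = 0"
  by (simp add: zero_mfps_def)

lemma mfps_nth_add [simp]: "mfps_nth (f + g) M = mfps_nth f M + mfps_nth g M"
  by (simp add: plus_mfps_def)

lemma mfps_nth_diff [simp]: "mfps_nth (f - g) M = mfps_nth f M - mfps_nth g M"
  by (simp add: minus_mfps_def)

lemma mfps_nth_sum: "mfps_nth (\<Sum>k\<in>A. f k) M = (\<Sum>k\<in>A. mfps_nth (f k) M)"
  by (induction A rule: infinite_finite_induct) auto

lemma mfps_nth_deriv:
  "mfps_nth (mfps_deriv k f) M = of_nat (count M k + 1) * mfps_nth f (add_mset k M)"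
  by (simp add: mfps_deriv_def)

lemma mfps_nth_const_mult [simp]: "mfps_nth (mfps_const c * f) M = c * mfps_nth f M"
proof -
  have "mfps_nth (mfps_const c * f) M
      = (\<Sum>p\<in>{(A, B). A + B = M}. if ({#}, M) = p then c * mfps_nth f M else 0)"
    unfolding times_mfps_def mfps_const_def mfps_nth_Abs
    by (rule sum.cong) (auto simp: prod_eq_iff)
  then show ?thesis
    by (simp add: sum.delta' finite_multiset_splits)
qed

lemma mfps_nth_var_mult:
  "mfps_nth (mfps_var k * f) M = (if k \<in># M then mfps_nth f (M - {#k#}) else 0)"
proof (cases "k \<in># M")
  case True
  have "mfps_nth (mfps_var k * f) M = (\<Sum>p\<in>{(A, B). A + B = M}.
      if ({#k#}, M - {#k#}) = p then mfps_nth f (M - {#k#}) else 0)"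
    unfolding times_mfps_def mfps_var_def mfps_nth_Abs
    by (rule sum.cong) (use True in \<open>auto simp: prod_eq_iff\<close>)
  then show ?thesis
    using True by (simp add: sum.delta' finite_multiset_splits)
next
  case False
  then show ?thesis
    by (auto simp: times_mfps_def mfps_var_def intro!: sum.neutral)
qed

lemma mfps_const_diff: "mfps_const (a - b) = mfps_const a - (mfps_const b :: ('n, complex) mfps)"
  by (rule mfps_eqI) (simp add: mfps_const_def)

definition mfps_euler :: "('n::finite, 'a::comm_ring_1) mfps \<Rightarrow> ('n, 'a) mfps" where
  "mfps_euler f = (\<Sum>k\<in>UNIV. mfps_var k * mfps_deriv k f)"

lemma mfps_nth_euler: "mfps_nth (mfps_euler f) M = of_nat (size M) * mfps_nth f M"
proof -
  have "mfps_nth (mfps_var k * mfps_deriv k f) M = of_nat (count M k) * mfps_nth f M" for k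
  proof (cases "k \<in># M")
    case True
    then obtain N where "M = add_mset k N"
      by (meson mset_add)
    then show ?thesis
      by (simp add: mfps_nth_var_mult mfps_nth_deriv)
  next
    case False
    then have "count M k = 0"
      by (simp add: not_in_iff)
    with False show ?thesis
      by (simp add: mfps_nth_var_mult)
  qed
  then have "mfps_nth (mfps_euler f) M = of_nat (\<Sum>k\<in>UNIV. count M k) * mfps_nth f M"
    by (simp add: mfps_euler_def mfps_nth_sum sum_distrib_right)
  also have "(\<Sum>k\<in>UNIV. count M k) = size M"
    unfolding size_multiset_overloaded_eq
    by (rule sum.mono_neutral_right) (auto simp: not_in_iff)
  finally show ?thesis .
qed

section \<open>Agreement up to a degree\<close>

definition mfps_agree :: "nat \<Rightarrow> ('n, 'a) mfps \<Rightarrow> ('n, 'a) mfps \<Rightarrow> bool" where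
  "mfps_agree n f g \<longleftrightarrow> (\<forall>M. size M < n \<longrightarrow> mfps_nth f M = mfps_nth g M)"

lemma mfps_agreeI: "(\<And>M. size M < n \<Longrightarrow> mfps_nth f M = mfps_nth g M) \<Longrightarrow> mfps_agree n f g"
  by (simp add: mfps_agree_def)

lemma mfps_agreeD: "mfps_agree n f g \<Longrightarrow> size M < n \<Longrightarrow> mfps_nth f M = mfps_nth g M"
  by (simp add: mfps_agree_def)

lemma mfps_agree_add:
  "mfps_agree n f f' \<Longrightarrow> mfps_agree n g g' \<Longrightarrow> mfps_agree n (f + g) (f' + g')"
  by (simp add: mfps_agree_def)

lemma mfps_agree_diff:
  "mfps_agree n f f' \<Longrightarrow> mfps_agree n g g' \<Longrightarrow> mfps_agree n (f - g) (f' - g')"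
  by (simp add: mfps_agree_def)

lemma mfps_agree_sum:
  "(\<And>k. k \<in> A \<Longrightarrow> mfps_agree n (f k) (g k)) \<Longrightarrow> mfps_agree n (\<Sum>k\<in>A. f k) (\<Sum>k\<in>A. g k)"
  by (simp add: mfps_agree_def mfps_nth_sum)

lemma mfps_agree_const_mult:
  "mfps_agree n f g \<Longrightarrow> mfps_agree n (mfps_const c * f) (mfps_const c * g)"
  by (simp add: mfps_agree_def)

lemma mfps_agree_const_mult_cancel:
  fixes c :: "'a::idom"
  shows "c \<noteq> 0 \<Longrightarrow> mfps_agree n (mfps_const c * f) (mfps_const c * g) \<Longrightarrow> mfps_agree n f g"
  by (simp add: mfps_agree_def)

lemma mfps_agree_mult:
  assumes "mfps_agree n f f'" "mfps_agree n g g'"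
  shows "mfps_agree n (f * g) (f' * g')"
proof (rule mfps_agreeI)
  fix M :: "'a multiset" assume M: "size M < n"
  show "mfps_nth (f * g) M = mfps_nth (f' * g') M"
    unfolding times_mfps_def mfps_nth_Abs
    by (rule sum.cong) (use M in \<open>auto simp: mfps_agreeD[OF assms(1)] mfps_agreeD[OF assms(2)]\<close>)
qed

lemma mfps_agree_euler: "mfps_agree n f g \<Longrightarrow> mfps_agree n (mfps_euler f) (mfps_euler g)"
  by (simp add: mfps_agree_def mfps_nth_euler)

text \<open>
  Characteristic zero enters here: a coefficient of positive degree can be recovered from a
  partial derivative, up to the multiplicity of the variable.
\<close>

lemma mfps_agree_Suc_if_derivs_agree:
  fixes f g :: "('n, 'a::{idom, ring_char_0}) mfps"
  assumes "mfps_nth f {#} = mfps_nth g {#}"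
    and "\<And>k. mfps_agree n (mfps_deriv k f) (mfps_deriv k g)"
  shows "mfps_agree (Suc n) f g"
proof (rule mfps_agreeI)
  fix M :: "'n multiset" assume M: "size M < Suc n"
  show "mfps_nth f M = mfps_nth g M"
  proof (cases M)
    case (add k N)
    then have "mfps_nth (mfps_deriv k f) N = mfps_nth (mfps_deriv k g) N"
      using M by (intro mfps_agreeD[OF assms(2)]) simp
    moreover have "(of_nat (count N k + 1) :: 'a) \<noteq> 0"
      by (metis Suc_eq_plus1 of_nat_neq_0)
    ultimately show ?thesis
      unfolding mfps_nth_deriv add by (metis mult_left_cancel)
  qed (simp add: assms(1))
qed

section \<open>The degreewise step\<close>

locale homogeneous_darboux_egoroff =
  fixes \<delta> :: "'n::finite \<Rightarrow> complex"
    and uo :: "complex ^ 'n"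
    and f :: "'n \<Rightarrow> 'n \<Rightarrow> ('n, complex) mfps"
  assumes deriv_distinct:
      "\<lbrakk>i \<noteq> j; k \<noteq> i; k \<noteq> j\<rbrakk> \<Longrightarrow> mfps_deriv k (f i j) = f i k * f k j"
    and translation: "i \<noteq> j \<Longrightarrow> (\<Sum>k\<in>UNIV. mfps_deriv k (f i j)) = 0"
    and homogeneity: "i \<noteq> j \<Longrightarrow>
      (\<Sum>k\<in>UNIV. coord_at uo k * mfps_deriv k (f i j)) = mfps_const (\<delta> j - \<delta> i - 1) * f i j"
begin

lemma shifted_homogeneity:
  assumes "i \<noteq> j"
  shows "(\<Sum>k\<in>UNIV. mfps_const (uo $ k - a) * mfps_deriv k (f i j)) + mfps_euler (f i j)
    = mfps_const (\<delta> j - \<delta> i - 1) * f i j"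
proof -
  let ?D = "\<lambda>k. mfps_deriv k (f i j)"
  have "(\<Sum>k\<in>UNIV. mfps_const (uo $ k - a) * ?D k) + mfps_euler (f i j)
      = (\<Sum>k\<in>UNIV. coord_at uo k * ?D k) - mfps_const a * (\<Sum>k\<in>UNIV. ?D k)"
    unfolding mfps_euler_def coord_at_def mfps_const_diff sum_distrib_left
      sum_subtractf[symmetric] sum.distrib[symmetric]
    by (rule sum.cong) (simp_all add: algebra_simps)
  then show ?thesis
    by (simp add: translation homogeneity assms)
qed

end

lemma homogeneous_darboux_egoroff_if_formal_solution:
  fixes \<delta> :: "'n::finite \<Rightarrow> complex"
  assumes "darboux_egoroff_formal_solution \<delta> uo F"
  shows "homogeneous_darboux_egoroff \<delta> uo (mfps_entry F)"
proof
  note sol = assms[unfolded darboux_egoroff_formal_solution_def Let_def]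
  fix i j k :: 'n
  assume ij: "i \<noteq> j"
  show "mfps_deriv k (mfps_entry F i j) = mfps_entry F i k * mfps_entry F k j"
    if "k \<noteq> i" "k \<noteq> j"
    using conjunct1[OF sol, rule_format, of i j k] ij that by simp
  note eqs = conjunct2[OF sol, rule_format, OF ij]
  show "(\<Sum>k\<in>UNIV. mfps_deriv k (mfps_entry F i j)) = 0"
    by (rule conjunct1[OF eqs])
  show "(\<Sum>k\<in>UNIV. coord_at uo k * mfps_deriv k (mfps_entry F i j))
      = mfps_const (\<delta> j - \<delta> i - 1) * mfps_entry F i j"
    by (rule conjunct1[OF conjunct2[OF eqs]])
qed

locale two_solutions =
  F: homogeneous_darboux_egoroff \<delta> uo f + G: homogeneous_darboux_egoroff \<delta> uo g
  for \<delta> :: "'n::finite \<Rightarrow> complex" and uo f g +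
  fixes n :: nat
  assumes agree: "i \<noteq> j \<Longrightarrow> mfps_agree n (f i j) (g i j)"
    and n_pos: "n > 0"
begin

lemma agree_deriv_other:
  assumes "i \<noteq> j" "k \<noteq> i" "k \<noteq> j"
  shows "mfps_agree n (mfps_deriv k (f i j)) (mfps_deriv k (g i j))"
  using assms by (simp add: F.deriv_distinct G.deriv_distinct agree mfps_agree_mult)

text \<open>
  When \<open>p\<close> and \<open>q\<close> are \<open>i\<close> and \<open>j\<close> in either order, the shift \<open>a = u\<^sub>o\<^sup>q\<close> leaves
  \<open>\<partial>\<^sub>p\<close> as the only derivative that is not yet known to agree.
\<close>

lemma agree_deriv_endpoint:
  assumes ij: "i \<noteq> j" and pq: "{p, q} = {i, j}" and neq: "uo $ p \<noteq> uo $ q"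
  shows "mfps_agree n (mfps_deriv p (f i j)) (mfps_deriv p (g i j))"
proof -
  let ?c = "\<lambda>k. mfps_const (uo $ k - uo $ q) :: ('n, complex) mfps"
  let ?R = "\<lambda>h. mfps_const (\<delta> j - \<delta> i - 1) * h - mfps_euler h
    - (\<Sum>k\<in>UNIV - {p}. ?c k * mfps_deriv k h)"
  have solve: "?c p * mfps_deriv p h = ?R h"
    if "(\<Sum>k\<in>UNIV. ?c k * mfps_deriv k h) + mfps_euler h = mfps_const (\<delta> j - \<delta> i - 1) * h"
    for h
    using that[symmetric] by (simp add: sum.remove[of UNIV p])
  have other: "mfps_agree n (?c k * mfps_deriv k (f i j)) (?c k * mfps_deriv k (g i j))"
    if "k \<in> UNIV - {p}" for k
  proof (cases "k = q")
    case True
    then show ?thesis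
      by (simp add: mfps_agree_def)
  next
    case False
    then have "k \<noteq> i" "k \<noteq> j"
      using that pq by auto
    then show ?thesis
      using ij by (intro mfps_agree_const_mult agree_deriv_other)
  qed
  have "mfps_agree n (?R (f i j)) (?R (g i j))"
    by (intro mfps_agree_diff mfps_agree_euler mfps_agree_const_mult[OF agree[OF ij]]
        mfps_agree_sum[of "UNIV - {p}"] other agree ij)
  then have "mfps_agree n (?c p * mfps_deriv p (f i j)) (?c p * mfps_deriv p (g i j))"
    using solve[OF F.shifted_homogeneity[OF ij]] solve[OF G.shifted_homogeneity[OF ij]]
    by simp
  then show ?thesis
    by (rule mfps_agree_const_mult_cancel[rotated]) (use neq in simp)
qed

lemma agree_step_distinct:
  assumes "uo $ i \<noteq> uo $ j"
  shows "mfps_agree (Suc n) (f i j) (g i j)"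
proof -
  have ij: "i \<noteq> j"
    using assms by auto
  show ?thesis
  proof (rule mfps_agree_Suc_if_derivs_agree)
    show "mfps_nth (f i j) {#} = mfps_nth (g i j) {#}"
      using mfps_agreeD[OF agree[OF ij]] n_pos by simp
    show "mfps_agree n (mfps_deriv k (f i j)) (mfps_deriv k (g i j))" for k
      using agree_deriv_other[OF ij, of k] agree_deriv_endpoint[OF ij, of i j]
        agree_deriv_endpoint[OF ij, of j i] assms
      by (cases "k = i"; cases "k = j") (auto simp: insert_commute)
  qed
qed

lemma agree_step_coalescing:
  assumes ij: "i \<noteq> j" and eq: "uo $ i = uo $ j" and res: "\<delta> i - \<delta> j \<notin> \<int> - {0}"
  shows "mfps_agree (Suc n) (f i j) (g i j)"
proof (rule mfps_agreeI)
  fix M :: "'n multiset" assume M: "size M < Suc n"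
  let ?\<mu> = "\<delta> j - \<delta> i - 1"
  let ?S = "\<lambda>h. \<Sum>k\<in>UNIV. mfps_const (uo $ k - uo $ i) * mfps_deriv k h"
  have summand: "mfps_agree (Suc n) (mfps_const (uo $ k - uo $ i) * mfps_deriv k (f i j))
      (mfps_const (uo $ k - uo $ i) * mfps_deriv k (g i j))" for k
  proof (cases "uo $ k = uo $ i")
    case True
    then show ?thesis
      by (simp add: mfps_agree_def)
  next
    case False
    then have neq: "uo $ i \<noteq> uo $ k" "uo $ k \<noteq> uo $ j"
      using eq by auto
    then have "k \<noteq> i" "k \<noteq> j"
      by auto
    moreover have "mfps_agree (Suc n) (f i k * f k j) (g i k * g k j)"
      by (intro mfps_agree_mult agree_step_distinct neq)
    ultimately show ?thesis
      by (simp add: F.deriv_distinct[OF ij] G.deriv_distinct[OF ij] mfps_agree_const_mult)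
  qed
  have S: "mfps_nth (?S (f i j)) M = mfps_nth (?S (g i j)) M"
    by (rule mfps_agreeD[OF mfps_agree_sum[OF summand] M])
  have Ef: "mfps_nth (?S (f i j)) M + of_nat (size M) * mfps_nth (f i j) M
      = ?\<mu> * mfps_nth (f i j) M"
    using arg_cong[OF F.shifted_homogeneity[OF ij, of "uo $ i"], of "\<lambda>h. mfps_nth h M"]
    by (simp only: mfps_nth_add mfps_nth_const_mult mfps_nth_euler)
  have Eg: "mfps_nth (?S (g i j)) M + of_nat (size M) * mfps_nth (g i j) M
      = ?\<mu> * mfps_nth (g i j) M"
    using arg_cong[OF G.shifted_homogeneity[OF ij, of "uo $ i"], of "\<lambda>h. mfps_nth h M"]
    by (simp only: mfps_nth_add mfps_nth_const_mult mfps_nth_euler)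
  have "(of_nat (size M) - ?\<mu>) * (mfps_nth (f i j) M - mfps_nth (g i j) M) = 0"
    unfolding right_diff_distrib left_diff_distrib[of "of_nat (size M)" ?\<mu>]
    by (simp only: Ef[symmetric] Eg[symmetric] S) simp
  moreover have "of_nat (size M) \<noteq> ?\<mu>"
  proof
    assume "of_nat (size M) = ?\<mu>"
    then have "\<delta> i - \<delta> j = - of_nat (Suc (size M))"
      by (simp add: algebra_simps)
    then have "\<delta> i - \<delta> j \<in> \<int> - {0}"
      using of_nat_neq_0[of "size M", where ?'a = complex]
      by (simp del: of_nat_Suc)
    with res show False ..
  qed
  ultimately show "mfps_nth (f i j) M = mfps_nth (g i j) M"
    by simp
qed

end

section \<open>Uniqueness\<close>

text \<open>
  For symmetric coefficients all lists enumerating a monomial contribute equally to its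
  coefficient, so each of them can be read off from the series.
\<close>

lemma mfps_nth_of_symmetric_coeffs:
  assumes "symmetric_coeffs c"
  shows "mfps_nth (mfps_of_coeffs c) (mset l)
    = (of_nat (card (permutations_of_multiset (mset l))) / fact (length l)) *\<^sub>R c l"
proof -
  have "c l' = c l" if "l' \<in> permutations_of_multiset (mset l)" for l'
    using that assms unfolding symmetric_coeffs_def
    by (metis permutations_of_multisetD)
  then have "mfps_nth (mfps_of_coeffs c) (mset l)
      = (\<Sum>l'\<in>permutations_of_multiset (mset l). (1 / fact (length l)) *\<^sub>R c l)"
    by (simp add: mfps_of_coeffs_def)
  then show ?thesis
    by (simp add: sum_constant_scaleR)
qed

theorem lemma6p24:
  fixes \<delta> :: "'n::finite \<Rightarrow> complex"
    and uo :: "complex ^ 'n"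
    and F G :: "'n list \<Rightarrow> complex ^ 'n ^ 'n"
  assumes "(\<forall>i j. i \<noteq> j \<longrightarrow> uo $ i \<noteq> uo $ j) \<or>
      (\<not> (\<forall>i j. i \<noteq> j \<longrightarrow> uo $ i \<noteq> uo $ j) \<and>
       (\<forall>i j. i \<noteq> j \<and> uo $ i = uo $ j \<longrightarrow> \<delta> i - \<delta> j \<notin> \<int> - {0}))"
    and "symmetric_coeffs F" and "symmetric_coeffs G"
    and "darboux_egoroff_formal_solution \<delta> uo (mfps_of_coeffs F)"
    and "darboux_egoroff_formal_solution \<delta> uo (mfps_of_coeffs G)"
    and "\<forall>i j. i \<noteq> j \<longrightarrow> F [] $ i $ j = G [] $ i $ j"
  shows "\<forall>l i j. i \<noteq> j \<longrightarrow> F l $ i $ j = G l $ i $ j"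
proof (intro allI impI)
  fix l :: "'n list" and i j :: 'n
  assume "i \<noteq> j"
  let ?f = "mfps_entry (mfps_of_coeffs F)" and ?g = "mfps_entry (mfps_of_coeffs G)"
  have res: "\<delta> i - \<delta> j \<notin> \<int> - {0}" if "i \<noteq> j" "uo $ i = uo $ j" for i j
    using assms(1) that by blast
  interpret F: homogeneous_darboux_egoroff \<delta> uo ?f
    by (rule homogeneous_darboux_egoroff_if_formal_solution) fact
  interpret G: homogeneous_darboux_egoroff \<delta> uo ?g
    by (rule homogeneous_darboux_egoroff_if_formal_solution) fact
  have "mfps_agree (Suc m) (?f i j) (?g i j)" if "i \<noteq> j" for m i j
    using that
  proof (induction m arbitrary: i j)
    case 0
    then show ?case
      using assms(6) by (simp add: mfps_agree_def mfps_entry_def mfps_of_coeffs_def)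
  next
    case (Suc m)
    interpret two_solutions \<delta> uo ?f ?g "Suc m"
      by unfold_locales (use Suc.IH in auto)
    show ?case
    proof (cases "uo $ i = uo $ j")
      case True
      then show ?thesis
        by (intro agree_step_coalescing res Suc.prems)
    qed (rule agree_step_distinct)
  qed
  from mfps_agreeD[OF this[OF \<open>i \<noteq> j\<close>, of "length l"], of "mset l"]
  have "mfps_nth (?f i j) (mset l) = mfps_nth (?g i j) (mset l)"
    by simp
  moreover have "card (permutations_of_multiset (mset l)) \<noteq> 0"
    by (simp add: permutations_of_multiset_not_empty)
  ultimately show "F l $ i $ j = G l $ i $ j"
    by (simp add: mfps_entry_def mfps_nth_of_symmetric_coeffs assms(2,3))
qed

end
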